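(* Let $n\ge 1$. The center of gravity of the classical (Loday) associahedron $\mathrm{Asso}(S_n)\subset\mathbb R^n$ is $G=\left(\frac{n+1}{2},\frac{n+1}{2},\dots,\frac{n+1}{2}\right)\in\mathbb R^n$; that is, $\sum_{T\in\mathcal T_{n+2}}\left(M(T)-G\right)=0$.
   Context: Write $[n]=\{1,\dots,n\}$. Let $P$ be a regular $(n+2)$-gon in the Euclidean plane with vertices $A_0,A_1,\dots,A_{n+1}$ in counterclockwise order. A triangle of $P$ is a triangle whose vertices are vertices of $P$ (so each of its sides is an edge or a diagonal of $P$). A triangulation $T$ of $P$ is a collection of $n$ distinct triangles of $P$ with pairwise noncrossing sides (equivalently, a set of $n-1$ pairwise noncrossing diagonals cutting $P$ into $n$ triangles). $\mathcal T_{n+2}$ denotes the set of all triangulations of $P$. For $T\in\mathcal T_{n+2}$ and $j\in[n]$, there is a unique triangle $\Delta_j(T)=A_iA_jA_k$ in $T$ with $0\le i<j<k\le n+1$; its weight is $\delta_j(T)=(j-i)(k-j)$. Put $M(T)=(\delta_1(T),\dots,\delta_n(T))\in\mathbb R^n$. The classical associahedron $\mathrm{Asso}(S_n)$ is the convex hull of the points $M(T)$, $T\in\mathcal T_{n+2}$; its vertices are the points $M(T)$, which are pairwise distinct. The center of gravity (isobarycenter) of this polytope is the isobarycenter of its vertices, i.e. the unique point $G\in\mathbb R^n$ with $\sum_{T\in\mathcal T_{n+2}}(M(T)-G)=0$. *)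

theory Defs
  imports "HOL-Analysis.Analysis"
begin

text \<open>The regular polygon with \<open>n + 2\<close> vertices is realised in the complex plane, inscribed in the
  unit circle. Its vertices are referred to by their indices \<open>0, \<dots>, n + 1\<close>; a triangle is
  the set of its three vertex indices, and a side is the set of its two endpoint indices.\<close>

definition polygon_vertex :: "nat \<Rightarrow> nat \<Rightarrow> complex" where
  "polygon_vertex n j = cis (2 * pi * real j / real (n + 2))"

definition polygon_triangles :: "nat \<Rightarrow> nat set set" where
  "polygon_triangles n = {t. t \<subseteq> {0..n + 1} \<and> card t = 3}"

definition triangle_sides :: "nat set \<Rightarrow> nat set set" where
  "triangle_sides t = {s. s \<subseteq> t \<and> card s = 2}"

definition open_side :: "nat \<Rightarrow> nat set \<Rightarrow> complex set" where
  "open_side n s = rel_interior (convex hull (polygon_vertex n ` s))"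

text \<open>Two different sides are noncrossing if they meet at most in endpoints, i.e. if the
  segments without their endpoints are disjoint.\<close>

definition triangulations :: "nat \<Rightarrow> nat set set set" where
  "triangulations n =
    {T. T \<subseteq> polygon_triangles n \<and> card T = n \<and>
        pairwise (\<lambda>s s'. disjnt (open_side n s) (open_side n s')) (\<Union>t\<in>T. triangle_sides t)}"

definition middle_triangle :: "nat set set \<Rightarrow> nat \<Rightarrow> nat set" where
  "middle_triangle T j = (THE t. t \<in> T \<and> (\<exists>i k. i < j \<and> j < k \<and> t = {i, j, k}))"

definition triangle_weight :: "nat set set \<Rightarrow> nat \<Rightarrow> nat" where
  "triangle_weight T j =
    (let t = middle_triangle T j in (j - Min t) * (Max t - j))"

text \<open>Points of \<open>\<real>\<^sup>n\<close> are vectors over a finite index type whose elements are numbered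
  \<open>1, \<dots>, n\<close> by a bijection \<open>e\<close>.\<close>

definition loday_point :: "('d::finite \<Rightarrow> nat) \<Rightarrow> nat set set \<Rightarrow> real ^ 'd" where
  "loday_point e T = (\<chi> a. real (triangle_weight T (e a)))"

definition associahedron :: "nat \<Rightarrow> ('d::finite \<Rightarrow> nat) \<Rightarrow> (real ^ 'd) set" where
  "associahedron n e = convex hull (loday_point e ` triangulations n)"

text \<open>The center of gravity of a polytope is the isobarycenter of its vertices (not the centroid
  of the solid body).\<close>

definition polytope_vertices :: "'a::real_vector set \<Rightarrow> 'a set" where
  "polytope_vertices S = {v. v extreme_point_of S}"

definition center_of_gravity :: "'a::real_vector set \<Rightarrow> 'a" where
  "center_of_gravity S =
    (1 / real (card (polytope_vertices S))) *\<^sub>R \<Sum>(polytope_vertices S)"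

end

theory Submission
  imports Defs "HOL-Computational_Algebra.Formal_Power_Series"
begin

text \<open>A triangulation of the polygon is a binary tree in disguise: the triangle on the base side
  \<open>{0, n + 1}\<close> is the root, and the parts of the polygon to its left and right are the two
  subtrees. Under this bijection (\<open>triangulations_eq_trees\<close>) the weight \<open>\<delta>\<^sub>j\<close> becomes
  Loday's coordinate of the \<open>j\<close>-th node in in-order,
  \<open>(size l + 1) * (size r + 1)\<close> for a node with subtrees \<open>l\<close> and \<open>r\<close>, so the statement is about
  the vectors of tree weights.

  Balance. Fix a coordinate and sum its weight over all trees with \<open>n\<close> nodes, split according to
  the position of the root. By induction all summands can be expressed by Catalan numbers \<open>C\<^sub>k\<close>, and
  the ratio \<open>(k + 2) C\<^sub>k\<^sub>+\<^sub>1 = (4 k + 2) C\<^sub>k\<close> shows that the result is the same for neighbouring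
  coordinates. As the weights of one tree always add up to \<open>n (n + 1) / 2\<close>
  (\<open>tree_weight_total\<close>), the common value is \<open>(n + 1) / 2\<close> times the number of trees
  (\<open>weight_sum_eq\<close>).

  Vertices. To pass from this sum over triangulations to the center of gravity, which averages over
  the extreme points of the convex hull, the points must be pairwise distinct (\<open>tree_weight_inj\<close>)
  and all extreme. For the latter, every weight vector satisfies the inequalities stating that \<open>m\<close>
  consecutive coordinates have sum at least \<open>m (m + 1) / 2\<close>, and a tree satisfies with equality
  those that belong to its subtrees. These equalities determine the point, so it
  cannot lie inside a segment of the polyhedron that the inequalities cut out
  (\<open>loday_polyhedron_extreme\<close>).\<close>

section \<open>Crossing chords of the regular polygon\<close>

text \<open>Twice the signed area of the triangle \<open>x y z\<close>, positive iff it is traversed counterclockwise. All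
  facts about crossing chords are read off from the signs of these areas.\<close>

definition orient :: "complex \<Rightarrow> complex \<Rightarrow> complex \<Rightarrow> real" where
  "orient x y z = Im (cnj (y - x) * (z - x))"

lemma orient_cyclic: "orient x y z = orient y z x"
  by (simp add: orient_def algebra_simps)

lemma orient_swap: "orient x z y = - orient x y z"
  by (simp add: orient_def algebra_simps)

lemma orient_convex_combination:
  "orient x y ((1 - u) *\<^sub>R z + u *\<^sub>R w) = (1 - u) * orient x y z + u * orient x y w"
  by (simp add: orient_def algebra_simps)

text \<open>On the unit circle, twice the signed area factors as \<open>4 sin x sin y sin (x + y)\<close>, where \<open>x\<close> and \<open>y\<close> are half of the two
  central angles; these half angles and their sum lie strictly between \<open>0\<close> and \<open>\<pi>\<close>.\<close>

lemma orient_polygon_vertex_pos: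
  assumes "a < b" "b < c" "c \<le> n + 1"
  shows "orient (polygon_vertex n a) (polygon_vertex n b) (polygon_vertex n c) > 0"
proof -
  define N where "N = real (n + 2)"
  have N: "N > 0" by (simp add: N_def)
  define \<alpha> where "\<alpha> = 2 * pi * real a / N"
  define x where "x = pi * real (b - a) / N"
  define y where "y = pi * real (c - b) / N"
  have \<beta>: "2 * pi * real b / N = \<alpha> + 2 * x" and \<gamma>: "2 * pi * real c / N = \<alpha> + 2 * x + 2 * y"
    using assms N by (simp_all add: \<alpha>_def x_def y_def field_simps of_nat_diff)
  have pos: "x > 0" "y > 0"
    using assms N by (simp_all add: x_def y_def)
  have "x + y = pi * (real (c - a) / N)"
    using assms N by (simp add: x_def y_def field_simps of_nat_diff)
  moreover have "real (c - a) / N < 1"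
    using assms by (simp add: N_def)
  ultimately have "x + y < pi"
    using mult_strict_left_mono[of "real (c - a) / N" 1 pi] by simp
  then have "sin x > 0" "sin y > 0" "sin (x + y) > 0"
    using pos by (auto intro!: sin_gt_zero)
  then have "4 * sin x * sin y * sin (x + y) > 0"
    by simp
  moreover have "orient (cis \<alpha>) (cis (\<alpha> + 2 * x)) (cis (\<alpha> + 2 * x + 2 * y))
      = sin (2 * x) + sin (2 * y) - sin (2 * x + 2 * y)"
  proof -
    have *: "cnj (cis s - cis r) * (cis t - cis r) = cis (t - s) - cis (r - s) - cis (t - r) + 1"
      for r s t
      by (simp add: algebra_simps cis_cnj cis_mult)
    show ?thesis
      unfolding orient_def * by (simp add: algebra_simps)
  qed
  moreover have "sin (2 * x) + sin (2 * y) - sin (2 * x + 2 * y) = 4 * sin x * sin y * sin (x + y)"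
  proof -
    have "sin (2 * x) + sin (2 * y) - sin (2 * x + 2 * y)
        = 2 * sin x * cos x * (1 - cos (2 * y)) + 2 * sin y * cos y * (1 - cos (2 * x))"
      by (simp only: sin_add sin_double) (simp add: algebra_simps)
    also have "\<dots> = 4 * sin x * sin y * sin (x + y)"
      by (simp only: cos_double_sin sin_add) (simp add: algebra_simps power2_eq_square)
    finally show ?thesis .
  qed
  ultimately show ?thesis
    unfolding polygon_vertex_def N_def[symmetric] \<beta> \<gamma> \<alpha>_def[symmetric] by simp
qed

lemma open_side_pair:
  "polygon_vertex n a \<noteq> polygon_vertex n b \<Longrightarrow>
    open_side n {a, b} = open_segment (polygon_vertex n a) (polygon_vertex n b)"
  by (simp add: open_side_def segment_convex_hull[symmetric] rel_interior_closed_segment)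

lemma polygon_vertex_neq:
  assumes "a < b" "b \<le> n + 1" "n \<ge> 1"
  shows "polygon_vertex n a \<noteq> polygon_vertex n b"
proof -
  \<comment> \<open>A third vertex exists, and with it the two vertices span a triangle of positive area.\<close>
  consider "b < n + 1" | "0 < a" | "a + 1 < b" using assms by linarith
  then show ?thesis
  proof cases
    case 1
    then show ?thesis
      using orient_polygon_vertex_pos[of a b "n + 1" n] assms by (auto simp: orient_def)
  next
    case 2
    then show ?thesis
      using orient_polygon_vertex_pos[of 0 a b n] assms by (auto simp: orient_def algebra_simps)
  next
    case 3
    then show ?thesis
      using orient_polygon_vertex_pos[of a "a + 1" b n] assms by (auto simp: orient_def algebra_simps)
  qed
qed

text \<open>Up to sign, the signed areas of the four triangles spanned by \<open>A, B, C, D\<close> are the coefficients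
  of the affine dependence of these points. For interleaved chords it reads
  \<open>p A + r C = q B + s D\<close> with positive coefficients and \<open>p + r = q + s\<close>; dividing by this sum gives a
  common point of the chords.\<close>

lemma interleaved_sides_meet:
  assumes "a < b" "b < c" "c < d" "d \<le> n + 1"
  shows "\<not> disjnt (open_side n {a, c}) (open_side n {b, d})"
proof -
  let ?V = "polygon_vertex n"
  define A B C D where "A = ?V a" and "B = ?V b" and "C = ?V c" and "D = ?V d"
  note defs = A_def B_def C_def D_def
  define p q r s where "p = orient B C D" and "q = orient A C D" and "r = orient A B D"
    and "s = orient A B C"
  have pos: "p > 0" "q > 0" "r > 0" "s > 0"
    unfolding p_def q_def r_def s_def defs using assms
    by (auto intro!: orient_polygon_vertex_pos)
  have total: "p + r = q + s"
    by (simp add: p_def q_def r_def s_def orient_def algebra_simps)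
  have balance: "p *\<^sub>R A + r *\<^sub>R C = q *\<^sub>R B + s *\<^sub>R D"
    by (rule complex_eqI; simp add: p_def q_def r_def s_def orient_def algebra_simps)
  define z where "z = (1 / (p + r)) *\<^sub>R (p *\<^sub>R A + r *\<^sub>R C)"
  have AC: "A \<noteq> C" and BD: "B \<noteq> D"
    using pos unfolding s_def p_def by (auto simp: orient_def algebra_simps)
  have "z = (1 - r / (p + r)) *\<^sub>R A + (r / (p + r)) *\<^sub>R C"
    using pos by (simp add: z_def scaleR_right_distrib field_simps)
  then have "z \<in> open_segment A C"
    using AC pos unfolding in_segment by (intro conjI exI[of _ "r / (p + r)"]) auto
  moreover have "z = (1 - s / (q + s)) *\<^sub>R B + (s / (q + s)) *\<^sub>R D"
    using pos unfolding z_def balance total by (simp add: scaleR_right_distrib field_simps)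
  then have "z \<in> open_segment B D"
    using BD pos unfolding in_segment by (intro conjI exI[of _ "s / (q + s)"]) auto
  moreover have "open_side n {a, c} = open_segment A C" "open_side n {b, d} = open_segment B D"
    using assms AC BD by (auto simp: open_side_pair defs)
  ultimately show ?thesis
    by (auto simp: disjnt_def)
qed

text \<open>The line through \<open>A\<^sub>a\<close> and \<open>A\<^sub>b\<close> separates: the signed area \<open>f\<close> against this chord vanishes on
  the chord, whereas the endpoints of the other chord lie weakly on one side of it and not both on
  it, so \<open>f\<close> has no zero in the open second chord.\<close>

lemma noninterleaved_sides_disjoint:
  assumes ab: "a < b" "b \<le> n + 1" and cd: "c < d" "d \<le> n + 1" and "n \<ge> 1"
    and distinct: "{a, b} \<noteq> {c, d}"
    and nc: "\<not> (a < c \<and> c < b \<and> b < d)" "\<not> (c < a \<and> a < d \<and> d < b)"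
  shows "disjnt (open_side n {a, b}) (open_side n {c, d})"
proof -
  let ?V = "polygon_vertex n"
  define f where "f z = orient (?V a) (?V b) z" for z
  have inside: "f (?V x) < 0" if "a < x" "x < b" for x
    using orient_polygon_vertex_pos[of a x b n] that ab orient_swap[of "?V a" "?V b" "?V x"]
    by (simp add: f_def)
  have left: "f (?V x) > 0" if "x < a" for x
    using orient_polygon_vertex_pos[of x a b n] that ab orient_cyclic[of "?V x" "?V a" "?V b"]
    by (simp add: f_def)
  have right: "f (?V x) > 0" if "b < x" "x \<le> n + 1" for x
    using orient_polygon_vertex_pos[of a b x n] that ab by (simp add: f_def)
  have ends: "f (?V a) = 0" "f (?V b) = 0"
    by (simp_all add: f_def orient_def algebra_simps)
  have nonpos: "f (?V x) \<le> 0" if "a \<le> x" "x \<le> b" for x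
    using inside[of x] ends that by (cases "x = a"; cases "x = b") auto
  have nonneg: "f (?V x) \<ge> 0" if "x \<le> a \<or> b \<le> x" "x \<le> n + 1" for x
    using left[of x] right[of x] ends that by (cases "x = a"; cases "x = b") auto
  have nonzero: "f (?V x) \<noteq> 0" if x: "x \<noteq> a" "x \<noteq> b" "x \<le> n + 1" for x
  proof -
    consider "x < a" | "b < x" | "a < x" "x < b" using x by linarith
    then show ?thesis using left[of x] right[of x] inside[of x] x by cases auto
  qed
  have some: "f (?V c) \<noteq> 0 \<or> f (?V d) \<noteq> 0"
    using nonzero[of c] nonzero[of d] distinct ab cd by fastforce
  have same: "f (?V c) \<le> 0 \<and> f (?V d) \<le> 0 \<or> f (?V c) \<ge> 0 \<and> f (?V d) \<ge> 0"
  proof -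
    have "(a \<le> c \<and> d \<le> b) \<or> ((c \<le> a \<or> b \<le> c) \<and> (d \<le> a \<or> b \<le> d))"
      using nc ab cd by linarith
    then show ?thesis
      using nonpos[of c] nonpos[of d] nonneg[of c] nonneg[of d] ab cd by fastforce
  qed
  have False if z: "z \<in> open_segment (?V a) (?V b)" "z \<in> open_segment (?V c) (?V d)" for z
  proof -
    obtain u where u: "z = (1 - u) *\<^sub>R ?V a + u *\<^sub>R ?V b"
      using z(1) unfolding in_segment by blast
    obtain v where v: "0 < v" "v < 1" "z = (1 - v) *\<^sub>R ?V c + v *\<^sub>R ?V d"
      using z(2) unfolding in_segment by blast
    have "f z = 0"
      using ends unfolding u f_def orient_convex_combination by simp
    moreover have "f z = (1 - v) * f (?V c) + v * f (?V d)"
      unfolding v f_def orient_convex_combination ..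
    ultimately have 0: "(1 - v) * f (?V c) + v * f (?V d) = 0" by simp
    from same show False
    proof
      assume s: "f (?V c) \<le> 0 \<and> f (?V d) \<le> 0"
      have "(1 - v) * f (?V c) \<le> 0" "v * f (?V d) \<le> 0"
        using s v by (auto simp: mult_le_0_iff)
      then have "(1 - v) * f (?V c) = 0" "v * f (?V d) = 0" using 0 by linarith+
      then show False using some v by auto
    next
      assume s: "f (?V c) \<ge> 0 \<and> f (?V d) \<ge> 0"
      have "(1 - v) * f (?V c) \<ge> 0" "v * f (?V d) \<ge> 0"
        using s v by auto
      then have "(1 - v) * f (?V c) = 0" "v * f (?V d) = 0" using 0 by linarith+
      then show False using some v by auto
    qed
  qed
  then show ?thesis
    using ab cd polygon_vertex_neq[of a b n] polygon_vertex_neq[of c d n] \<open>n \<ge> 1\<close>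
    by (auto simp: open_side_pair disjnt_def)
qed

section \<open>Triangulations as noncrossing sets of triangles\<close>

text \<open>Quantifying over pairs of vertices of two triangles ranges over their sides, since a triangle has
  all its vertex pairs as sides; the strict inequalities exclude equal sides.\<close>

definition noncrossing :: "nat set set \<Rightarrow> bool" where
  "noncrossing T \<longleftrightarrow>
    (\<forall>t\<in>T. \<forall>t'\<in>T. \<forall>a\<in>t. \<forall>c\<in>t. \<forall>b\<in>t'. \<forall>d\<in>t'. \<not> (a < b \<and> b < c \<and> c < d))"

definition triangles_between :: "nat \<Rightarrow> nat \<Rightarrow> nat set set" where
  "triangles_between a b = {t. t \<subseteq> {a..b} \<and> card t = 3}"

lemma noncrossingD:
  "noncrossing T \<Longrightarrow> t \<in> T \<Longrightarrow> t' \<in> T \<Longrightarrow> a \<in> t \<Longrightarrow> c \<in> t \<Longrightarrow> b \<in> t' \<Longrightarrow> d \<in> t' \<Longrightarrow>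
    a < b \<Longrightarrow> b < c \<Longrightarrow> c < d \<Longrightarrow> False"
  unfolding noncrossing_def by blast

lemma noncrossing_subset: "S \<subseteq> T \<Longrightarrow> noncrossing T \<Longrightarrow> noncrossing S"
  unfolding noncrossing_def by (meson subsetD)

lemma card_2_nat_obtains:
  fixes s :: "nat set"
  assumes "card s = 2"
  obtains a b where "a < b" "s = {a, b}"
  using assms unfolding card_2_iff by (metis insert_commute linorder_neqE_nat)

lemma card_3_nat_obtains:
  fixes t :: "nat set"
  assumes "card t = 3"
  obtains i j k where "i < j" "j < k" "t = {i, j, k}"
proof -
  obtain x y z where t: "t = {x, y, z}" "x \<noteq> y" "y \<noteq> z" "x \<noteq> z"
    using assms unfolding card_3_iff by blast
  consider "x < y" "y < z" | "x < z" "z < y" | "y < x" "x < z" | "y < z" "z < x"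
    | "z < x" "x < y" | "z < y" "y < x"
    using t by linarith
  then show thesis
  proof cases
    case 1 then show thesis using that[of x y z] t by blast
  next
    case 2 then show thesis using that[of x z y] t by blast
  next
    case 3 then show thesis using that[of y x z] t by blast
  next
    case 4 then show thesis using that[of y z x] t by blast
  next
    case 5 then show thesis using that[of z x y] t by blast
  next
    case 6 then show thesis using that[of z y x] t by blast
  qed
qed

lemma sides_disjoint_iff_noncrossing:
  assumes T: "T \<subseteq> polygon_triangles n" and "n \<ge> 1"
  shows "pairwise (\<lambda>s s'. disjnt (open_side n s) (open_side n s')) (\<Union>t\<in>T. triangle_sides t)
    \<longleftrightarrow> noncrossing T" (is "?disjoint \<longleftrightarrow> _")
proof
  assume dis: ?disjoint
  show "noncrossing T"
    unfolding noncrossing_def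
  proof (intro ballI notI)
    fix t t' a c b d
    assume m: "t \<in> T" "t' \<in> T" "a \<in> t" "c \<in> t" "b \<in> t'" "d \<in> t'" and lt: "a < b \<and> b < c \<and> c < d"
    have "{a, c} \<in> (\<Union>t\<in>T. triangle_sides t)" "{b, d} \<in> (\<Union>t\<in>T. triangle_sides t)"
      using m lt unfolding triangle_sides_def by (force, force)
    moreover have "{a, c} \<noteq> {b, d}" using lt by auto
    ultimately have "disjnt (open_side n {a, c}) (open_side n {b, d})"
      by (rule pairwiseD[OF dis])
    moreover have "t' \<subseteq> {0..n + 1}"
      using m(2) T by (auto simp: polygon_triangles_def)
    then have "d \<le> n + 1"
      using m(6) by auto
    ultimately show False
      using interleaved_sides_meet[of a b c d n] lt by blast
  qed
next
  assume nc: "noncrossing T"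
  show ?disjoint
    unfolding pairwise_def
  proof (intro ballI impI)
    fix s s'
    assume s: "s \<in> (\<Union>t\<in>T. triangle_sides t)" and s': "s' \<in> (\<Union>t\<in>T. triangle_sides t)"
      and "s \<noteq> s'"
    obtain t where t: "t \<in> T" "s \<subseteq> t" "card s = 2"
      using s by (auto simp: triangle_sides_def)
    obtain t' where t': "t' \<in> T" "s' \<subseteq> t'" "card s' = 2"
      using s' by (auto simp: triangle_sides_def)
    obtain a b where ab: "a < b" "s = {a, b}" using card_2_nat_obtains t(3) by blast
    obtain c d where cd: "c < d" "s' = {c, d}" using card_2_nat_obtains t'(3) by blast
    have sub: "t \<subseteq> {0..n+1}" "t' \<subseteq> {0..n+1}"
      using T t(1) t'(1) by (auto simp: polygon_triangles_def)
    have le: "b \<le> n + 1" "d \<le> n + 1"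
      using sub t(2) t'(2) ab(2) cd(2) by auto
    have "\<not> (a < c \<and> c < b \<and> b < d)" "\<not> (c < a \<and> a < d \<and> d < b)"
      using noncrossingD[OF nc t(1) t'(1), of a b c d] noncrossingD[OF nc t'(1) t(1), of c d a b]
        t t' ab cd by auto
    then show "disjnt (open_side n s) (open_side n s')"
      using noninterleaved_sides_disjoint[of a b n c d] ab cd le \<open>s \<noteq> s'\<close> \<open>n \<ge> 1\<close> by blast
  qed
qed

lemma triangulations_iff_noncrossing:
  assumes "n \<ge> 1"
  shows "T \<in> triangulations n \<longleftrightarrow>
    T \<subseteq> triangles_between 0 (n + 1) \<and> card T = n \<and> noncrossing T"
  using sides_disjoint_iff_noncrossing[OF _ assms, of T]
  by (auto simp: triangulations_def polygon_triangles_def triangles_between_def)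

text \<open>If the outer vertices differed, a side ending in the common middle vertex \<open>j\<close> of one triangle
  would cross the longest side of the other.\<close>

lemma middle_vertex_determines_triangle:
  assumes nc: "noncrossing T" and t: "{i, j, k} \<in> T" "i < j" "j < k"
    and t': "{i', j, k'} \<in> T" "i' < j" "j < k'"
  shows "i = i' \<and> k = k'"
proof -
  have "\<not> i < i'" using noncrossingD[OF nc t(1) t'(1), of i j i' k'] t t' by auto
  moreover have "\<not> i' < i" using noncrossingD[OF nc t'(1) t(1), of i' j i k] t t' by auto
  moreover have "\<not> k < k'" using noncrossingD[OF nc t(1) t'(1), of i k j k'] t t' by auto
  moreover have "\<not> k' < k" using noncrossingD[OF nc t'(1) t(1), of i' k' j k] t t' by auto
  ultimately show ?thesis by auto
qed

text \<open>A triangle is determined by its middle vertex, and only \<open>b - a - 1\<close> vertices can be a middle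
  vertex. So a noncrossing set with that many triangles uses every one of them.\<close>

lemma noncrossing_card_bound:
  assumes T: "T \<subseteq> triangles_between a b" and nc: "noncrossing T"
  shows "card T \<le> b - a - 1"
    and "card T = b - a - 1 \<Longrightarrow> a < j \<Longrightarrow> j < b \<Longrightarrow> \<exists>i k. i < j \<and> j < k \<and> {i, j, k} \<in> T"
proof -
  have "\<exists>j. a < j \<and> j < b \<and> (\<exists>i k. i < j \<and> j < k \<and> t = {i, j, k})" if t: "t \<in> T" for t
  proof -
    have t3: "card t = 3" "t \<subseteq> {a..b}" using T t by (auto simp: triangles_between_def)
    obtain i j k where "i < j" "j < k" "t = {i, j, k}" using card_3_nat_obtains t3(1) by blast
    moreover from this have "a \<le> i" "k \<le> b" using t3 by auto
    ultimately show ?thesis by (intro exI[of _ j]) auto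
  qed
  then obtain m where m: "a < m t \<and> m t < b \<and> (\<exists>i k. i < m t \<and> m t < k \<and> t = {i, m t, k})"
    if "t \<in> T" for t
    by metis
  have inj: "inj_on m T"
  proof (rule inj_onI)
    fix t t' assume t: "t \<in> T" and t': "t' \<in> T" and eq: "m t = m t'"
    obtain i k where 1: "i < m t" "m t < k" "t = {i, m t, k}" using m[OF t] by blast
    obtain i' k' where 2: "i' < m t" "m t < k'" "t' = {i', m t, k'}" using m[OF t'] eq by metis
    show "t = t'"
      using middle_vertex_determines_triangle[OF nc, of i "m t" k i' k'] t t' 1 2 by metis
  qed
  have sub: "m ` T \<subseteq> {a<..<b}" using m by auto
  have card_image: "card (m ` T) = card T" using inj by (rule card_image)
  then show "card T \<le> b - a - 1" using card_mono[OF _ sub] by simp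
  assume full: "card T = b - a - 1" and j: "a < j" "j < b"
  have "m ` T = {a<..<b}" using card_subset_eq[OF _ sub] card_image full by simp
  then have "j \<in> m ` T" using j by simp
  then obtain t where t: "t \<in> T" "j = m t" by blast
  then obtain i k where "i < j" "j < k" "t = {i, j, k}" using m[of t] by blast
  then show "\<exists>i k. i < j \<and> j < k \<and> {i, j, k} \<in> T" using t(1) by blast
qed

text \<open>A triangle of maximal span stands on the base: if its right end \<open>k\<close> were not \<open>b\<close>, the triangle
  with middle vertex \<open>k\<close> would reach at least as far to the left without crossing, hence have a
  larger span; the left end is symmetric.\<close>

lemma full_noncrossing_has_base_triangle:
  assumes T: "T \<subseteq> triangles_between a b" and nc: "noncrossing T"
    and full: "card T = b - a - 1" and "a + 1 < b"
  shows "\<exists>k. a < k \<and> k < b \<and> {a, k, b} \<in> T"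
proof -
  note middle = noncrossing_card_bound(2)[OF T nc full]
  define P where "P = (\<lambda>(i, k). \<exists>j. i < j \<and> j < k \<and> {i, j, k} \<in> T)"
  define span :: "nat \<times> nat \<Rightarrow> nat" where "span = (\<lambda>(i, k). k - i)"
  have range: "a \<le> i \<and> k \<le> b" if "P (i, k)" for i k
    using that T by (auto simp: P_def triangles_between_def)
  have "\<exists>x. P x" using middle[of "a + 1"] \<open>a + 1 < b\<close> by (auto simp: P_def)
  then obtain x0 where "P x0" ..
  moreover have "\<forall>y. P y \<longrightarrow> span y < b + 1"
    using range by (fastforce simp: span_def)
  ultimately obtain x where x: "P x" "\<And>y. P y \<Longrightarrow> span y \<le> span x"
    using ex_has_greatest_nat[of P x0 span "b + 1"] by blast
  obtain i k where ik: "x = (i, k)" by (cases x)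
  obtain j where j: "i < j" "j < k" "{i, j, k} \<in> T" using x(1) by (auto simp: P_def ik)
  have "k = b"
  proof (rule ccontr)
    assume "k \<noteq> b"
    then obtain i' k' where 1: "i' < k" "k < k'" "{i', k, k'} \<in> T"
      using middle[of k] range[of i k] x(1) ik j by fastforce
    have "i' \<le> i"
      using noncrossingD[OF nc j(3) 1(3), of i k i' k'] 1 by fastforce
    moreover have "P (i', k')" using 1 by (auto simp: P_def)
    ultimately show False using x(2)[of "(i', k')"] 1 j by (simp add: span_def ik)
  qed
  moreover have "i = a"
  proof (rule ccontr)
    assume "i \<noteq> a"
    then obtain i' k' where 1: "i' < i" "i < k'" "{i', i, k'} \<in> T"
      using middle[of i] range[of i k] x(1) ik j by fastforce
    have "k \<le> k'"
      using noncrossingD[OF nc 1(3) j(3), of i' k' i k] 1 by fastforce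
    moreover have "P (i', k')" using 1 by (auto simp: P_def)
    ultimately show False using x(2)[of "(i', k')"] 1 j by (simp add: span_def ik)
  qed
  ultimately show ?thesis using j by auto
qed

section \<open>Triangulations and binary trees\<close>

text \<open>The size of such a tree is the number of its inner nodes, which correspond to triangles.\<close>

datatype btree = Leaf | Node btree btree

fun tree_triangles :: "nat \<Rightarrow> btree \<Rightarrow> nat set set" where
  "tree_triangles a Leaf = {}"
| "tree_triangles a (Node l r) =
    insert {a, a + size l + 1, a + size l + size r + 2}
      (tree_triangles a l \<union> tree_triangles (a + size l + 1) r)"

lemma tree_triangles_between: "tree_triangles a t \<subseteq> triangles_between a (a + size t + 1)"
proof (induction t arbitrary: a)
  case (Node l r)
  from Node(1)[of a] Node(2)[of "a + size l + 1"] show ?case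
    by (fastforce simp: triangles_between_def)
qed simp

text \<open>A vertex strictly between \<open>a\<close> and \<open>k\<close> only occurs in triangles of \<open>L\<close>, and one strictly between
  \<open>k\<close> and \<open>b\<close> only in triangles of \<open>R\<close>. The two middle ones of four interleaved vertices
  differ from \<open>a\<close> and \<open>b\<close>, which forces both triangles into the same part.\<close>

lemma noncrossing_glue:
  assumes L: "noncrossing L" "\<Union>L \<subseteq> {a..k}" and R: "noncrossing R" "\<Union>R \<subseteq> {k..b}"
    and "a < k" "k < b"
  shows "noncrossing (insert {a, k, b} (L \<union> R))"
proof -
  have L': "v \<in> {a..k}" if "t \<in> L" "v \<in> t" for t v using L(2) that by blast
  have R': "v \<in> {k..b}" if "t \<in> R" "v \<in> t" for t v using R(2) that by blast
  have range: "a \<le> v \<and> v \<le> b" if "t \<in> insert {a, k, b} (L \<union> R)" "v \<in> t" for t v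
    using that L'[of t v] R'[of t v] \<open>a < k\<close> \<open>k < b\<close> by auto
  have left: "t \<in> L" if "t \<in> insert {a, k, b} (L \<union> R)" "v \<in> t" "a < v" "v < k" for t v
    using that R'[of t v] \<open>k < b\<close> by auto
  have right: "t \<in> R" if "t \<in> insert {a, k, b} (L \<union> R)" "v \<in> t" "k < v" "v < b" for t v
    using that L'[of t v] \<open>a < k\<close> by auto
  show ?thesis
    unfolding noncrossing_def
  proof (intro ballI notI)
    fix t t' x z y w
    assume t: "t \<in> insert {a, k, b} (L \<union> R)" and t': "t' \<in> insert {a, k, b} (L \<union> R)"
      and xz: "x \<in> t" "z \<in> t" and yw: "y \<in> t'" "w \<in> t'" and lt: "x < y \<and> y < z \<and> z < w"
    have inner: "a < y" "z < b" using range[OF t xz(1)] range[OF t' yw(2)] lt by auto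
    consider "y < k" | "y = k" | "k < y" by linarith
    then show False
    proof cases
      case 1
      then have "t' \<in> L" using left[OF t' yw(1)] inner by simp
      moreover from this have "t \<in> L" using left[OF t xz(2)] L'[of t' w] yw lt inner by auto
      ultimately show False using noncrossingD[OF L(1) _ _ xz yw] lt by blast
    next
      case 2
      then have "t \<in> R" using right[OF t xz(2)] lt inner by simp
      then show False using R'[of t x] xz lt 2 by simp
    next
      case 3
      then have "t' \<in> R" "t \<in> R" using right[OF t' yw(1)] right[OF t xz(2)] lt inner by simp_all
      then show False using noncrossingD[OF R(1) _ _ xz yw] lt by blast
    qed
  qed
qed

lemma noncrossing_tree_triangles: "noncrossing (tree_triangles a t)"
proof (induction t arbitrary: a)
  case Leaf
  show ?case by (simp add: noncrossing_def)
next
  case (Node l r)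
  have "\<Union>(tree_triangles a l) \<subseteq> {a..a + size l + 1}"
    using tree_triangles_between[of a l] by (auto simp: triangles_between_def)
  moreover have "\<Union>(tree_triangles (a + size l + 1) r) \<subseteq> {a + size l + 1..a + size l + size r + 2}"
    using tree_triangles_between[of "a + size l + 1" r] by (fastforce simp: triangles_between_def)
  ultimately show ?case
    using noncrossing_glue[OF Node(1)[of a] _ Node(2)[of "a + size l + 1"]] by simp
qed

lemma finite_tree_triangles: "finite (tree_triangles a t)"
  by (induction t arbitrary: a) auto

lemma card_tree_triangles: "card (tree_triangles a t) = size t"
proof (induction t arbitrary: a)
  case (Node l r)
  let ?k = "a + size l + 1" and ?b = "a + size l + size r + 2"
  have L: "x \<subseteq> {a..?k}" "card x = 3" if "x \<in> tree_triangles a l" for x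
    using tree_triangles_between[of a l] that by (auto simp: triangles_between_def)
  have R: "x \<subseteq> {?k..?b}" if "x \<in> tree_triangles ?k r" for x
    using tree_triangles_between[of ?k r] that by (fastforce simp: triangles_between_def)
  have disj: "tree_triangles a l \<inter> tree_triangles ?k r = {}"
  proof -
    have False if "x \<in> tree_triangles a l" "x \<in> tree_triangles ?k r" for x
    proof -
      have "x \<subseteq> {?k}" using L(1)[OF that(1)] R[OF that(2)] by fastforce
      then have "card x \<le> 1" using card_mono[of "{?k}" x] by simp
      then show False using L(2)[OF that(1)] by simp
    qed
    then show ?thesis by blast
  qed
  have new: "{a, ?k, ?b} \<notin> tree_triangles a l \<union> tree_triangles ?k r"
    using L(1)[of "{a, ?k, ?b}"] R[of "{a, ?k, ?b}"] by auto
  have "card (tree_triangles a (Node l r))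
      = Suc (card (tree_triangles a l \<union> tree_triangles ?k r))"
    using new by (simp add: finite_tree_triangles)
  also have "\<dots> = Suc (size l + size r)"
    using disj Node by (simp add: card_Un_disjoint finite_tree_triangles)
  finally show ?case by simp
qed simp

text \<open>No triangle can cross the sides \<open>{a, k}\<close> and \<open>{k, b}\<close> of the triangle on the base, so all
  others lie on its left or on its right. Both parts then attain the maximal number of triangles,
  because together they do, and the induction applies to them.\<close>

lemma full_noncrossing_is_tree:
  assumes "T \<subseteq> triangles_between a (a + n + 1)" "noncrossing T" "card T = n"
  shows "\<exists>t. size t = n \<and> T = tree_triangles a t"
  using assms
proof (induction n arbitrary: a T rule: less_induct)
  case (less n)
  note T = less.prems(1) and nc = less.prems(2) and full = less.prems(3)
  have fin: "finite T"
    using T by (rule finite_subset) (simp add: triangles_between_def)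
  show ?case
  proof (cases "n = 0")
    case True
    then show ?thesis using full fin by (intro exI[of _ Leaf]) simp
  next
    case False
    define b where "b = a + n + 1"
    obtain k where k: "a < k" "k < b" "{a, k, b} \<in> T"
      using full_noncrossing_has_base_triangle[of T a b] T nc full False by (auto simp: b_def)
    define L where "L = {t \<in> T. t \<subseteq> {a..k}}"
    define R where "R = {t \<in> T. t \<subseteq> {k..b}}"
    have L: "L \<subseteq> triangles_between a k" and R: "R \<subseteq> triangles_between k b"
      using T by (auto simp: L_def R_def triangles_between_def)
    have ncL: "noncrossing L" and ncR: "noncrossing R"
      by (rule noncrossing_subset[OF _ nc]; auto simp: L_def R_def)+
    have split: "T = insert {a, k, b} (L \<union> R)"
    proof
      show "T \<subseteq> insert {a, k, b} (L \<union> R)"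
      proof
        fix t assume t: "t \<in> T"
        have t3: "card t = 3" "t \<subseteq> {a..b}" using T t by (auto simp: triangles_between_def b_def)
        obtain x y z where xyz: "x < y" "y < z" "t = {x, y, z}"
          using card_3_nat_obtains t3(1) by blast
        have ends: "a \<le> x" "z \<le> b" using t3 xyz by auto
        consider "y < k" | "y = k" | "k < y" by linarith
        then show "t \<in> insert {a, k, b} (L \<union> R)"
        proof cases
          case 1
          have "z \<le> k" using noncrossingD[OF nc k(3) t, of a k y z] 1 xyz ends by fastforce
          then show ?thesis using t xyz ends by (auto simp: L_def)
        next
          case 2
          then show ?thesis
            using middle_vertex_determines_triangle[OF nc, of x k z a b] t k xyz by auto
        next
          case 3
          have "k \<le> x" using noncrossingD[OF nc t k(3), of x y k b] 3 xyz ends by fastforce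
          then show ?thesis using t xyz ends by (auto simp: R_def)
        qed
      qed
      show "insert {a, k, b} (L \<union> R) \<subseteq> T" using k by (auto simp: L_def R_def)
    qed
    have fLR: "finite L" "finite R" using fin by (auto simp: L_def R_def)
    have "card T \<le> Suc (card L + card R)"
      unfolding split using fLR card_Un_le[of L R] card_insert_le_m1
      by (simp add: card_insert_if)
    moreover have "card L \<le> k - a - 1" "card R \<le> b - k - 1"
      using noncrossing_card_bound(1)[OF L ncL] noncrossing_card_bound(1)[OF R ncR] by auto
    ultimately have cL: "card L = k - a - 1" and cR: "card R = b - k - 1"
      using full k by (auto simp: b_def)
    obtain l where l: "size l = k - a - 1" "L = tree_triangles a l"
    proof -
      have "k - a - 1 < n" "a + (k - a - 1) + 1 = k" using k by (auto simp: b_def)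
      then show thesis using less.IH[of "k - a - 1" L a] L ncL cL that by metis
    qed
    obtain r where r: "size r = b - k - 1" "R = tree_triangles k r"
    proof -
      have "b - k - 1 < n" "k + (b - k - 1) + 1 = b" using k by (auto simp: b_def)
      then show thesis using less.IH[of "b - k - 1" R k] R ncR cR that by metis
    qed
    have ks: "k = a + size l + 1" and bs: "b = a + size l + size r + 2"
      using l r k by auto
    have "T = tree_triangles a (Node l r)"
      unfolding tree_triangles.simps ks[symmetric] bs[symmetric] using split l(2) r(2) by simp
    moreover have "size (Node l r) = n" using l r k by (simp add: b_def)
    ultimately show ?thesis by blast
  qed
qed

definition trees :: "nat \<Rightarrow> btree set" where
  "trees n = {t. size t = n}"

lemma triangulations_eq_trees:
  assumes "n \<ge> 1"
  shows "triangulations n = tree_triangles 0 ` trees n"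
proof (intro equalityI subsetI)
  fix T assume "T \<in> triangulations n"
  then show "T \<in> tree_triangles 0 ` trees n"
    using full_noncrossing_is_tree[of T 0 n] assms
    by (auto simp: triangulations_iff_noncrossing trees_def)
next
  fix T assume "T \<in> tree_triangles 0 ` trees n"
  then show "T \<in> triangulations n"
    using assms tree_triangles_between[of 0] noncrossing_tree_triangles card_tree_triangles
    by (force simp: triangulations_iff_noncrossing trees_def)
qed

text \<open>Loday's coordinates. Positions are counted from \<open>0\<close> in in-order, so that position \<open>p\<close> belongs to
  the middle vertex \<open>p + 1\<close> of the polygon.\<close>

fun tree_weight :: "btree \<Rightarrow> nat \<Rightarrow> nat" where
  "tree_weight Leaf p = 0"
| "tree_weight (Node l r) p =
    (if p < size l then tree_weight l p
     else if p = size l then (size l + 1) * (size r + 1)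
     else tree_weight r (p - size l - 1))"

lemma tree_triangles_middle:
  assumes "p < size t"
  shows "\<exists>i k. i < a + p + 1 \<and> a + p + 1 < k \<and> {i, a + p + 1, k} \<in> tree_triangles a t
    \<and> tree_weight t p = (a + p + 1 - i) * (k - (a + p + 1))"
  using assms
proof (induction t arbitrary: a p)
  case (Node l r)
  consider "p < size l" | "p = size l" | "p > size l" by linarith
  then show ?case
  proof cases
    case 1
    then show ?thesis using Node.IH(1)[of p a] by auto
  next
    case 2
    then show ?thesis
      by (intro exI[of _ a] exI[of _ "a + size l + size r + 2"]) simp
  next
    case 3
    define q where "q = p - size l - 1"
    have q: "q < size r" "a + size l + 1 + q + 1 = a + p + 1" "tree_weight (Node l r) p = tree_weight r q"
      using 3 Node.prems by (auto simp: q_def)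
    then obtain i k where "i < a + p + 1" "a + p + 1 < k"
      "{i, a + p + 1, k} \<in> tree_triangles (a + size l + 1) r"
      "tree_weight r q = (a + p + 1 - i) * (k - (a + p + 1))"
      using Node.IH(2)[of q "a + size l + 1"] by metis
    then show ?thesis using q(3) by (intro exI[of _ i] exI[of _ k]) simp
  qed
qed simp

lemma triangle_weight_tree_triangles:
  assumes "p < size t"
  shows "triangle_weight (tree_triangles 0 t) (Suc p) = tree_weight t p"
proof -
  let ?T = "tree_triangles 0 t"
  obtain i k where ik: "i < Suc p" "Suc p < k" "{i, Suc p, k} \<in> ?T"
    "tree_weight t p = (Suc p - i) * (k - Suc p)"
    using tree_triangles_middle[OF assms, of 0] by auto
  have "middle_triangle ?T (Suc p) = {i, Suc p, k}"
    unfolding middle_triangle_def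
  proof (rule the_equality)
    show "{i, Suc p, k} \<in> ?T \<and> (\<exists>i' k'. i' < Suc p \<and> Suc p < k' \<and> {i, Suc p, k} = {i', Suc p, k'})"
      using ik by blast
  next
    fix x assume "x \<in> ?T \<and> (\<exists>i k. i < Suc p \<and> Suc p < k \<and> x = {i, Suc p, k})"
    then show "x = {i, Suc p, k}"
      using middle_vertex_determines_triangle[OF noncrossing_tree_triangles, of i "Suc p" k 0 t] ik
      by metis
  qed
  moreover have "Min {i, Suc p, k} = i" "Max {i, Suc p, k} = k"
    using ik by auto
  ultimately show ?thesis
    using ik(4) by (simp add: triangle_weight_def)
qed

section \<open>The points of the trees are the vertices\<close>

text \<open>An interval that contains the root position, with \<open>u\<close> positions to its left and \<open>e'\<close> to its right,
  gets at least \<open>u (u + 1) / 2 + e' (e' + 1) / 2\<close> from the two subtrees and at least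
  \<open>(u + 1) (e' + 1)\<close> from the root, which add up to the claim. Any other interval lies in one subtree.\<close>

lemma tree_weight_interval_sum:
  assumes "i \<le> e" "e \<le> size t"
  shows "(e - i) * (e - i + 1) \<le> 2 * (\<Sum>p\<in>{i..<e}. tree_weight t p)"
  using assms
proof (induction t arbitrary: i e)
  case (Node l r)
  consider "e \<le> size l" | "size l < i" | "i \<le> size l" "size l < e" by linarith
  then show ?case
  proof cases
    case 1
    then have "(\<Sum>p\<in>{i..<e}. tree_weight (Node l r) p) = (\<Sum>p\<in>{i..<e}. tree_weight l p)"
      by (intro sum.cong) auto
    then show ?thesis using Node.IH(1)[of i e] Node.prems 1 by simp
  next
    case 2
    define i' e' where "i' = i - size l - 1" and "e' = e - size l - 1"
    have ie: "i = i' + (size l + 1)" "e = e' + (size l + 1)"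
      using 2 Node.prems by (auto simp: i'_def e'_def)
    have "(\<Sum>p\<in>{i..<e}. tree_weight (Node l r) p) = (\<Sum>p\<in>{i'..<e'}. tree_weight r p)"
      unfolding ie sum.shift_bounds_nat_ivl by simp
    then show ?thesis using Node.IH(2)[of i' e'] Node.prems ie by simp
  next
    case 3
    define e' where "e' = e - size l - 1"
    have e: "e = e' + (size l + 1)" using 3 by (simp add: e'_def)
    have e'r: "e' \<le> size r" using Node.prems e by simp
    define u where "u = size l - i"
    have u: "size l = i + u" using 3 by (simp add: u_def)
    have "(\<Sum>p\<in>{i..<e}. tree_weight (Node l r) p)
        = (\<Sum>p\<in>{i..<size l}. tree_weight (Node l r) p)
          + (\<Sum>p\<in>{size l..<e}. tree_weight (Node l r) p)"
      using 3 by (intro sum.atLeastLessThan_concat[symmetric]) auto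
    also have "(\<Sum>p\<in>{size l..<e}. tree_weight (Node l r) p)
        = tree_weight (Node l r) (size l) + (\<Sum>p\<in>{Suc (size l)..<e}. tree_weight (Node l r) p)"
      using 3 by (simp add: sum.atLeast_Suc_lessThan)
    also have "(\<Sum>p\<in>{Suc (size l)..<e}. tree_weight (Node l r) p)
        = (\<Sum>p\<in>{0 + (size l + 1)..<e' + (size l + 1)}. tree_weight (Node l r) p)"
      using e by simp
    also have "\<dots> = (\<Sum>p\<in>{0..<e'}. tree_weight r p)"
      unfolding sum.shift_bounds_nat_ivl by simp
    also have "(\<Sum>p\<in>{i..<size l}. tree_weight (Node l r) p) = (\<Sum>p\<in>{i..<size l}. tree_weight l p)"
      by (intro sum.cong) auto
    finally have *: "(\<Sum>p\<in>{i..<e}. tree_weight (Node l r) p) = (\<Sum>p\<in>{i..<size l}. tree_weight l p)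
        + ((size l + 1) * (size r + 1) + (\<Sum>p\<in>{0..<e'}. tree_weight r p))"
      by simp
    have 1: "u * (u + 1) \<le> 2 * (\<Sum>p\<in>{i..<size l}. tree_weight l p)"
      using Node.IH(1)[of i "size l"] 3 by (simp add: u_def)
    have 2: "e' * (e' + 1) \<le> 2 * (\<Sum>p\<in>{0..<e'}. tree_weight r p)"
      using Node.IH(2)[of 0 e'] e'r by simp
    have "(u + 1) * (e' + 1) \<le> (size l + 1) * (size r + 1)"
      using e'r u by (intro mult_mono) auto
    then have "u * (u + 1) + 2 * ((u + 1) * (e' + 1)) + e' * (e' + 1)
        \<le> 2 * (\<Sum>p\<in>{i..<e}. tree_weight (Node l r) p)"
      unfolding * distrib_left[of 2] add.assoc[symmetric]
      by (intro add_mono[OF add_mono[OF 1 mult_left_mono] 2]) auto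
    moreover have "e - i = u + 1 + e'" using e u by simp
    moreover have "(u + 1 + e') * (u + 1 + e' + 1) = u * (u + 1) + 2 * ((u + 1) * (e' + 1)) + e' * (e' + 1)"
      by (simp add: algebra_simps)
    ultimately show ?thesis by simp
  qed
qed simp

lemma sum_Node_split:
  fixes x :: "nat \<Rightarrow> 'a::comm_monoid_add"
  shows "(\<Sum>p<size (Node l r). x (a + p))
    = (\<Sum>p<size l. x (a + p)) + (x (a + size l) + (\<Sum>p<size r. x (a + size l + 1 + p)))"
proof -
  have split: "(\<Sum>p<m + Suc k. y p) = (\<Sum>p<m. y p) + (y m + (\<Sum>p<k. y (m + 1 + p)))"
    for y :: "nat \<Rightarrow> 'a" and m k
    by (induction k) (simp_all add: ac_simps)
  have "size (Node l r) = size l + Suc (size r)" by simp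
  then show ?thesis
    by (simp only: split) (simp add: ac_simps)
qed

lemma tree_weight_total: "2 * (\<Sum>p<size t. tree_weight t p) = size t * (size t + 1)"
proof (induction t)
  case (Node l r)
  have "(\<Sum>p<size (Node l r). tree_weight (Node l r) p)
      = (\<Sum>p<size l. tree_weight l p) + ((size l + 1) * (size r + 1) + (\<Sum>p<size r. tree_weight r p))"
    using sum_Node_split[of "tree_weight (Node l r)" 0 l r] by simp
  then show ?case
    using Node by (simp add: algebra_simps)
qed simp

text \<open>Together with the equation for the sum of all coordinates, these inequalities are Loday's
  description of the associahedron by half-spaces. The point of a tree is a vertex of the region
  they define.\<close>

definition loday_polyhedron :: "nat \<Rightarrow> (nat \<Rightarrow> real) set" where
  "loday_polyhedron n = {x. \<forall>i m. i + m \<le> n \<longrightarrow> real (m * (m + 1)) / 2 \<le> (\<Sum>p<m. x (i + p))}"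

lemma loday_polyhedronD:
  "x \<in> loday_polyhedron n \<Longrightarrow> i + m \<le> n \<Longrightarrow> real (m * (m + 1)) / 2 \<le> (\<Sum>p<m. x (i + p))"
  unfolding loday_polyhedron_def by blast

lemma tree_weight_in_loday_polyhedron:
  "(\<lambda>p. real (tree_weight t p)) \<in> loday_polyhedron (size t)"
  unfolding loday_polyhedron_def
proof (intro CollectI allI impI)
  fix i m assume "i + m \<le> size t"
  then have "m * (m + 1) \<le> 2 * (\<Sum>p\<in>{i..<i + m}. tree_weight t p)"
    using tree_weight_interval_sum[of i "i + m" t] by simp
  also have "(\<Sum>p\<in>{i..<i + m}. tree_weight t p) = (\<Sum>p<m. tree_weight t (i + p))"
    using sum.shift_bounds_nat_ivl[of "tree_weight t" 0 i m] by (simp add: lessThan_atLeast0 ac_simps)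
  finally have "real (m * (m + 1)) \<le> real (2 * (\<Sum>p<m. tree_weight t (i + p)))"
    by (rule of_nat_mono)
  then show "real (m * (m + 1)) / 2 \<le> (\<Sum>p<m. real (tree_weight t (i + p)))"
    by simp
qed

lemma loday_polyhedron_convex:
  assumes "x \<in> loday_polyhedron n" "y \<in> loday_polyhedron n" "0 \<le> u" "0 \<le> v" "u + v = 1"
  shows "(\<lambda>p. u * x p + v * y p) \<in> loday_polyhedron n"
  unfolding loday_polyhedron_def
proof (intro CollectI allI impI)
  fix i m assume im: "i + m \<le> n"
  let ?c = "real (m * (m + 1)) / 2"
  have "?c \<le> (\<Sum>p<m. x (i + p))" "?c \<le> (\<Sum>p<m. y (i + p))"
    using assms im unfolding loday_polyhedron_def by auto
  then have "u * ?c + v * ?c \<le> u * (\<Sum>p<m. x (i + p)) + v * (\<Sum>p<m. y (i + p))"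
    using assms by (intro add_mono mult_left_mono) auto
  also have "u * ?c + v * ?c = ?c"
    using assms by (simp flip: distrib_right)
  finally show "?c \<le> (\<Sum>p<m. u * x (i + p) + v * y (i + p))"
    by (simp add: sum.distrib sum_distrib_left)
qed

text \<open>The inequality of each subtree interval holds with equality for the convex combination, hence for
  both \<open>x\<close> and \<open>y\<close>. Subtracting the interval sums of the two subtrees of a node from its own
  leaves the coordinate of that node.\<close>

lemma loday_polyhedron_extreme:
  assumes x: "x \<in> loday_polyhedron n" and y: "y \<in> loday_polyhedron n"
    and uv: "0 < u" "0 < v" "u + v = 1"
    and "a + size t \<le> n"
    and "\<And>p. p < size t \<Longrightarrow> u * x (a + p) + v * y (a + p) = real (tree_weight t p)"
  shows "(\<Sum>p<size t. x (a + p)) = real (size t * (size t + 1)) / 2 \<and>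
    (\<forall>p<size t. x (a + p) = real (tree_weight t p))"
  using assms(6,7)
proof (induction t arbitrary: a)
  case (Node l r)
  let ?t = "Node l r"
  let ?c = "real (size ?t * (size ?t + 1)) / 2"
  let ?X = "\<Sum>p<size ?t. x (a + p)" and ?Y = "\<Sum>p<size ?t. y (a + p)"
  have "real (2 * (\<Sum>p<size ?t. tree_weight ?t p)) = real (size ?t * (size ?t + 1))"
    by (simp only: tree_weight_total)
  then have "(\<Sum>p<size ?t. real (tree_weight ?t p)) = ?c"
    by simp
  moreover have "(\<Sum>p<size ?t. real (tree_weight ?t p)) = (\<Sum>p<size ?t. u * x (a + p) + v * y (a + p))"
    using Node.prems(2) by (intro sum.cong) auto
  ultimately have "u * ?X + v * ?Y = ?c"
    by (simp only: sum.distrib sum_distrib_left)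
  also have "\<dots> = u * ?c + v * ?c"
    using uv by (simp only: mult_1 flip: distrib_right)
  finally have *: "u * (?X - ?c) + v * (?Y - ?c) = 0"
    by (simp only: right_diff_distrib)
  have ge: "?X - ?c \<ge> 0" "?Y - ?c \<ge> 0"
    using loday_polyhedronD[OF x Node.prems(1)] loday_polyhedronD[OF y Node.prems(1)]
    by (simp_all only: diff_ge_0_iff_ge)
  have "u * (?X - ?c) \<ge> 0" "v * (?Y - ?c) \<ge> 0"
    using ge uv by (simp_all only: mult_nonneg_nonneg less_imp_le)
  then have "u * (?X - ?c) = 0"
    using * by linarith
  then have X: "?X = ?c"
    using uv by simp
  have l: "(\<Sum>p<size l. x (a + p)) = real (size l * (size l + 1)) / 2"
      "\<And>p. p < size l \<Longrightarrow> x (a + p) = real (tree_weight l p)"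
  proof -
    have "u * x (a + p) + v * y (a + p) = real (tree_weight l p)" if "p < size l" for p
      using Node.prems(2)[of p] that by simp
    then show "(\<Sum>p<size l. x (a + p)) = real (size l * (size l + 1)) / 2"
      "\<And>p. p < size l \<Longrightarrow> x (a + p) = real (tree_weight l p)"
      using Node.IH(1)[of a] Node.prems(1) by auto
  qed
  let ?b = "a + size l + 1"
  have r: "(\<Sum>p<size r. x (?b + p)) = real (size r * (size r + 1)) / 2"
      "\<And>p. p < size r \<Longrightarrow> x (?b + p) = real (tree_weight r p)"
  proof -
    have "u * x (?b + p) + v * y (?b + p) = real (tree_weight r p)" if "p < size r" for p
      using Node.prems(2)[of "size l + 1 + p"] that by (simp add: ac_simps)
    then show "(\<Sum>p<size r. x (?b + p)) = real (size r * (size r + 1)) / 2"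
      "\<And>p. p < size r \<Longrightarrow> x (?b + p) = real (tree_weight r p)"
      using Node.IH(2)[of ?b] Node.prems(1) by auto
  qed
  have "?c = real (size l * (size l + 1)) / 2 + (x (a + size l) + real (size r * (size r + 1)) / 2)"
    using X[unfolded sum_Node_split l(1) r(1)] by (rule sym)
  then have root: "x (a + size l) = real ((size l + 1) * (size r + 1))"
    by (simp add: algebra_simps add_divide_distrib)
  have "x (a + p) = real (tree_weight ?t p)" if "p < size ?t" for p
  proof -
    consider "p < size l" | "p = size l" | "p > size l" by linarith
    then show ?thesis
    proof cases
      case 3
      then have "p = size l + 1 + (p - size l - 1)" by simp
      then have "x (a + p) = real (tree_weight r (p - size l - 1))"
        using r(2)[of "p - size l - 1"] that by (simp add: ac_simps)
      then show ?thesis using 3 by simp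
    qed (use l(2) root in simp_all)
  qed
  with X show ?case by blast
qed simp

text \<open>A node at position \<open>p\<close> has at most \<open>p\<close> nodes in its left subtree and at most
  \<open>size t - p - 1\<close> in its right one.\<close>

lemma tree_weight_le:
  "p < size t \<Longrightarrow> tree_weight t p \<le> (p + 1) * (size t - p)"
proof (induction t arbitrary: p)
  case (Node l r)
  consider "p < size l" | "p = size l" | "p > size l" by linarith
  then show ?case
  proof cases
    case 1
    then have "tree_weight l p \<le> (p + 1) * (size l - p)" by (rule Node.IH)
    also have "\<dots> \<le> (p + 1) * (size (Node l r) - p)" by (intro mult_left_mono) auto
    finally show ?thesis using 1 by simp
  next
    case 3
    define q where "q = p - size l - 1"
    have q: "p = size l + 1 + q" "q < size r" using 3 Node.prems by (auto simp: q_def)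
    have "tree_weight r q \<le> (q + 1) * (size r - q)" using q(2) by (rule Node.IH)
    also have "\<dots> \<le> (p + 1) * (size (Node l r) - p)" using q by (intro mult_mono) auto
    finally show ?thesis using 3 by (simp add: q_def)
  qed simp
qed simp

text \<open>If the root position of the first tree lay in the left subtree \<open>l'\<close> of the second, its weight there
  would be bounded by \<open>(size l + 1) * (size l' - size l)\<close>, but it is
  \<open>(size l + 1) * (size r + 1)\<close>, and \<open>size l' - size l \<le> size r\<close>.\<close>

lemma root_position_unique:
  assumes "size (Node l r) = size (Node l' r')"
    and w: "\<And>p. p < size (Node l r) \<Longrightarrow> tree_weight (Node l r) p = tree_weight (Node l' r') p"
  shows "\<not> size l < size l'"
proof
  assume lt: "size l < size l'"
  have "(size l + 1) * (size r + 1) = tree_weight l' (size l)"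
    using w[of "size l"] lt by simp
  also have "\<dots> \<le> (size l + 1) * (size l' - size l)"
    using lt by (rule tree_weight_le)
  finally have "size r + 1 \<le> size l' - size l"
    by (simp only: mult_le_cancel1)
  then show False using assms(1) by simp
qed

lemma tree_weight_inj:
  assumes "size t = size t'" "\<And>p. p < size t \<Longrightarrow> tree_weight t p = tree_weight t' p"
  shows "t = t'"
  using assms
proof (induction t arbitrary: t')
  case Leaf
  then show ?case by (cases t') auto
next
  case (Node l r)
  from Node.prems(1) obtain l' r' where t': "t' = Node l' r'" by (cases t') auto
  note w = Node.prems[unfolded t']
  have "\<not> size l < size l'" using root_position_unique[OF w] .
  moreover have "\<not> size l' < size l"
    using root_position_unique[of l' r' l r] w by (metis (no_types))
  ultimately have eq: "size l = size l'" "size r = size r'" using w(1) by auto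
  have "l = l'"
  proof (rule Node.IH(1)[OF eq(1)])
    fix p assume "p < size l"
    then show "tree_weight l p = tree_weight l' p" using w(2)[of p] eq by simp
  qed
  moreover have "r = r'"
  proof (rule Node.IH(2)[OF eq(2)])
    fix p assume "p < size r"
    then show "tree_weight r p = tree_weight r' p" using w(2)[of "size l + 1 + p"] eq by simp
  qed
  ultimately show ?case using t' by simp
qed

section \<open>Counting trees\<close>

lemma trees_0: "trees 0 = {Leaf}"
proof -
  have "size t = 0 \<longleftrightarrow> t = Leaf" for t :: btree by (cases t) auto
  then show ?thesis by (auto simp: trees_def)
qed

lemma trees_Suc:
  "trees (Suc n) = (\<lambda>(k, l, r). Node l r) ` (SIGMA k:{..n}. trees k \<times> trees (n - k))"
proof (intro equalityI subsetI)
  fix t assume "t \<in> trees (Suc n)"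
  then obtain l r where "t = Node l r" "size l + size r = n"
    by (cases t) (auto simp: trees_def)
  then show "t \<in> (\<lambda>(k, l, r). Node l r) ` (SIGMA k:{..n}. trees k \<times> trees (n - k))"
    by (intro image_eqI[of _ _ "(size l, l, r)"]) (auto simp: trees_def)
qed (auto simp: trees_def)

lemma finite_trees: "finite (trees n)"
proof (induction n rule: less_induct)
  case (less n)
  show ?case
  proof (cases n)
    case 0 then show ?thesis by (simp add: trees_0)
  next
    case (Suc m)
    have "finite (SIGMA k:{..m}. trees k \<times> trees (m - k))"
      using less Suc by (intro finite_SigmaI finite_cartesian_product) auto
    then show ?thesis unfolding Suc trees_Suc by (rule finite_imageI)
  qed
qed

lemma sum_trees_Suc:
  "(\<Sum>t\<in>trees (Suc n). f t) = (\<Sum>k\<le>n. \<Sum>l\<in>trees k. \<Sum>r\<in>trees (n - k). f (Node l r))"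
proof -
  have "inj_on (\<lambda>(k, l, r). Node l r) (SIGMA k:{..n}. trees k \<times> trees (n - k))"
    by (auto simp: inj_on_def trees_def)
  then have "(\<Sum>t\<in>trees (Suc n). f t)
      = (\<Sum>(k, l, r)\<in>(SIGMA k:{..n}. trees k \<times> trees (n - k)). f (Node l r))"
    unfolding trees_Suc by (subst sum.reindex) (auto intro!: sum.cong)
  also have "\<dots> = (\<Sum>k\<le>n. \<Sum>(l, r)\<in>trees k \<times> trees (n - k). f (Node l r))"
    by (subst sum.Sigma) (auto simp: finite_trees)
  also have "\<dots> = (\<Sum>k\<le>n. \<Sum>l\<in>trees k. \<Sum>r\<in>trees (n - k). f (Node l r))"
    by (simp add: sum.cartesian_product)
  finally show ?thesis .
qed

definition catalan :: "nat \<Rightarrow> real" where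
  "catalan n = real (card (trees n))"

lemma catalan_0: "catalan 0 = 1"
  by (simp add: catalan_def trees_0)

lemma catalan_Suc: "catalan (Suc n) = (\<Sum>k\<le>n. catalan k * catalan (n - k))"
  using sum_trees_Suc[of "\<lambda>_. 1 :: real" n] by (simp add: catalan_def)

text \<open>The generating function satisfies \<open>C = 1 + X C\<^sup>2\<close>, so \<open>Y = 1 - 2 X C\<close> is the square root of
  \<open>1 - 4 X\<close>. Differentiating \<open>Y\<^sup>2 = 1 - 4 X\<close> yields the linear equation \<open>(1 - 4 X) Y' = - 2 Y\<close>,
  whose coefficients give the recurrence.\<close>

lemma catalan_ratio: "real (n + 2) * catalan (Suc n) = (4 * real n + 2) * catalan n"
proof -
  define C where "C = Abs_fps catalan"
  define Y where "Y = 1 - 2 * fps_X * C"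
  have C: "C = 1 + fps_X * C\<^sup>2"
  proof (rule fps_ext)
    have "fps_nth (C\<^sup>2) m = catalan (Suc m)" for m
      by (simp add: C_def catalan_Suc power2_eq_square fps_mult_nth atLeast0AtMost)
    then show "fps_nth C m = fps_nth (1 + fps_X * C\<^sup>2) m" for m
      by (cases m) (simp_all add: C_def catalan_0)
  qed
  have "Y\<^sup>2 = 1 - 4 * fps_X * (C - fps_X * C\<^sup>2)"
    by (simp add: Y_def power2_eq_square algebra_simps)
  also have "C - fps_X * C\<^sup>2 = 1"
    using C by (simp add: algebra_simps)
  finally have sq: "Y\<^sup>2 = 1 - 4 * fps_X" by simp
  have "2 * (Y * fps_deriv Y) = fps_deriv (Y\<^sup>2)"
    by (simp add: power2_eq_square algebra_simps)
  also have "\<dots> = 2 * (- 2)"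
    unfolding sq by (simp add: numeral_fps_const)
  finally have "Y * fps_deriv Y = - 2"
    by (simp only: mult_cancel_left) simp
  then have "Y\<^sup>2 * fps_deriv Y = - 2 * Y"
    by (simp add: power2_eq_square mult.assoc)
  then have "fps_deriv Y - 4 * (fps_X * fps_deriv Y) = - 2 * Y"
    unfolding sq by (simp add: algebra_simps)
  then have "fps_nth (fps_deriv Y - 4 * (fps_X * fps_deriv Y)) (Suc n) = fps_nth (- 2 * Y) (Suc n)"
    by simp
  moreover have "fps_nth Y (Suc m) = - 2 * catalan m" for m
    by (simp add: Y_def C_def mult.assoc numeral_fps_const)
  ultimately show ?thesis
    by (simp add: numeral_fps_const algebra_simps)
qed

section \<open>The mean weight of a position\<close>

definition weight_sum :: "nat \<Rightarrow> nat \<Rightarrow> real" where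
  "weight_sum n p = (\<Sum>t\<in>trees n. real (tree_weight t p))"

text \<open>The trees are grouped by the size \<open>k\<close> of the left subtree: position \<open>p\<close> lies in the right subtree for
  \<open>k < p\<close>, is the root for \<open>k = p\<close> and lies in the left subtree for \<open>k > p\<close>.\<close>

lemma weight_sum_Suc:
  assumes "p \<le> n"
  shows "weight_sum (Suc n) p =
    (\<Sum>k<p. catalan k * weight_sum (n - k) (p - k - 1))
    + (real (p + 1) * catalan p * (real (n - p + 1) * catalan (n - p))
      + (\<Sum>k\<in>{p<..n}. weight_sum k p * catalan (n - k)))"
proof -
  define g where "g k = (\<Sum>l\<in>trees k. \<Sum>r\<in>trees (n - k). real (tree_weight (Node l r) p))" for k
  have "{..n} = {..<p} \<union> ({p} \<union> {p<..n})" using assms by auto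
  then have "weight_sum (Suc n) p = (\<Sum>k\<in>{..<p} \<union> ({p} \<union> {p<..n}). g k)"
    by (simp only: weight_sum_def sum_trees_Suc g_def)
  also have "\<dots> = (\<Sum>k<p. g k) + (g p + (\<Sum>k\<in>{p<..n}. g k))"
    by (subst sum.union_disjoint; (auto simp: sum.union_disjoint)?)
  also have "(\<Sum>k<p. g k) = (\<Sum>k<p. catalan k * weight_sum (n - k) (p - k - 1))"
    by (intro sum.cong) (auto simp: g_def trees_def weight_sum_def catalan_def)
  also have "g p = catalan p * (catalan (n - p) * real ((p + 1) * (n - p + 1)))"
    by (simp add: g_def trees_def catalan_def)
  also have "\<dots> = real (p + 1) * catalan p * (real (n - p + 1) * catalan (n - p))"
    by (simp only: of_nat_mult mult_ac)
  also have "(\<Sum>k\<in>{p<..n}. g k) = (\<Sum>k\<in>{p<..n}. weight_sum k p * catalan (n - k))"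
    by (intro sum.cong) (auto simp: g_def trees_def weight_sum_def catalan_def sum_distrib_left mult.commute)
  finally show ?thesis .
qed

text \<open>By induction the root decomposition turns the sum into \<open>E p\<close>, an expression in Catalan numbers
  and in \<open>b k = (k + 1) C\<^sub>k\<close>, the central binomial coefficients. The Catalan ratio in the form
  \<open>2 b\<^sub>k - C\<^sub>k = b\<^sub>k\<^sub>+\<^sub>1 / 2\<close> makes \<open>E p\<close> independent of \<open>p\<close>. Summing over all positions then determines
  its value from the constant total weight of a tree.\<close>

lemma weight_sum_eq: "p < n \<Longrightarrow> weight_sum n p = (real n + 1) / 2 * catalan n"
proof (induction n arbitrary: p rule: less_induct)
  case (less n)
  then obtain m where n: "n = Suc m" by (cases n) auto
  define b where "b k = real (k + 1) * catalan k" for k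
  define E where "E p = (\<Sum>k<p. catalan k * b (m - k)) / 2 + (b p * b (m - p)
    + (\<Sum>k\<in>{p<..m}. b k * catalan (m - k)) / 2)" for p
  have E: "weight_sum n p = E p" if "p \<le> m" for p
  proof -
    have "(\<Sum>k<p. catalan k * weight_sum (m - k) (p - k - 1)) = (\<Sum>k<p. catalan k * b (m - k)) / 2"
      unfolding sum_divide_distrib using that
      by (intro sum.cong) (auto simp: less.IH n b_def algebra_simps)
    moreover have "(\<Sum>k\<in>{p<..m}. weight_sum k p * catalan (m - k))
        = (\<Sum>k\<in>{p<..m}. b k * catalan (m - k)) / 2"
      unfolding sum_divide_distrib using that
      by (intro sum.cong) (auto simp: less.IH n b_def algebra_simps)
    ultimately show ?thesis
      unfolding n weight_sum_Suc[OF that] by (simp add: E_def b_def)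
  qed
  have b_Suc: "2 * b k - catalan k = b (Suc k) / 2" for k
    using catalan_ratio[of k] by (simp add: b_def algebra_simps)
  have step: "E (Suc p) = E p" if "p < m" for p
  proof -
    define q where "q = m - Suc p"
    have q: "m - p = Suc q" "m - Suc p = q" using that by (auto simp: q_def)
    have "{p<..m} = insert (Suc p) {Suc p<..m}" using that by auto
    then have "(\<Sum>k\<in>{p<..m}. b k * catalan (m - k))
        = b (Suc p) * catalan q + (\<Sum>k\<in>{Suc p<..m}. b k * catalan (m - k))"
      using q by simp
    then have "2 * (E (Suc p) - E p) = (2 * b q - catalan q) * b (Suc p) - (2 * b p - catalan p) * b (Suc q)"
      by (simp add: E_def q algebra_simps add_divide_distrib)
    also have "\<dots> = 0"
      unfolding b_Suc by simp
    finally show ?thesis by simp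
  qed
  have const: "E p = E 0" if "p \<le> m" for p
    using that by (induction p) (auto simp: step)
  have common: "weight_sum n p = E 0" if "p < n" for p
    using E[of p] const[of p] that by (simp only: n less_Suc_eq_le)
  have "(\<Sum>p<n. weight_sum n p) = (\<Sum>p<n. E 0)"
    using common by (intro sum.cong) auto
  then have "real n * E 0 = (\<Sum>p<n. weight_sum n p)"
    by simp
  also have "\<dots> = (\<Sum>t\<in>trees n. \<Sum>p<n. real (tree_weight t p))"
    unfolding weight_sum_def by (rule sum.swap)
  also have "\<dots> = (\<Sum>t\<in>trees n. real n * (real n + 1) / 2)"
  proof (rule sum.cong)
    fix t assume "t \<in> trees n"
    then have "2 * (\<Sum>p<n. tree_weight t p) = n * (n + 1)"
      using tree_weight_total[of t] by (simp add: trees_def)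
    then have "real (2 * (\<Sum>p<n. tree_weight t p)) = real (n * (n + 1))" by (simp only:)
    then show "(\<Sum>p<n. real (tree_weight t p)) = real n * (real n + 1) / 2" by (simp add: algebra_simps)
  qed simp
  also have "\<dots> = real n * ((real n + 1) / 2 * catalan n)"
    by (simp add: catalan_def)
  finally have "E 0 = (real n + 1) / 2 * catalan n"
    by (simp add: n)
  then show ?case using common less.prems by simp
qed

section \<open>The vertices and the center of gravity of the associahedron\<close>

lemma loday_point_tree_triangles:
  assumes "bij_betw e UNIV {1..n}" "t \<in> trees n"
  shows "loday_point e (tree_triangles 0 t) $ a = real (tree_weight t (e a - 1))"
proof -
  have "e a \<in> {1..n}" using assms(1) by (auto simp: bij_betw_def)
  then have "e a - 1 < n" "Suc (e a - 1) = e a" by auto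
  then show ?thesis
    using assms(2) triangle_weight_tree_triangles[of "e a - 1" t]
    by (simp add: loday_point_def trees_def)
qed

lemma loday_point_coordinate:
  assumes "bij_betw e UNIV {1..n}" "t \<in> trees n" "p < n"
  shows "loday_point e (tree_triangles 0 t) $ inv e (Suc p) = real (tree_weight t p)"
proof -
  have "e (inv e (Suc p)) = Suc p"
    using assms by (intro f_inv_into_f) (auto simp: bij_betw_def)
  then show ?thesis
    using loday_point_tree_triangles[OF assms(1,2)] by simp
qed

text \<open>Vectors are compared through the numbering: coordinate \<open>p\<close> in the sense of trees is the one with
  index \<open>inv e (Suc p)\<close>.\<close>

lemma vec_eq_iff_coordinates:
  fixes v w :: "real ^ 'd"
  assumes "bij_betw e UNIV {1..n}"
  shows "v = w \<longleftrightarrow> (\<forall>p<n. v $ inv e (Suc p) = w $ inv e (Suc p))"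
proof -
  have "\<exists>p<n. a = inv e (Suc p)" for a
  proof -
    have "e a \<in> {1..n}" "inv e (e a) = a" using assms by (auto simp: bij_betw_def)
    then show ?thesis by (intro exI[of _ "e a - 1"]) auto
  qed
  then show ?thesis by (metis vec_eq_iff)
qed

lemma inj_on_loday_point:
  assumes "n \<ge> 1" and e: "bij_betw e UNIV {1..n}"
  shows "inj_on (\<lambda>t. loday_point e (tree_triangles 0 t)) (trees n)"
proof (rule inj_onI)
  fix t t' assume t: "t \<in> trees n" "t' \<in> trees n"
    and eq: "loday_point e (tree_triangles 0 t) = loday_point e (tree_triangles 0 t')"
  show "t = t'"
  proof (rule tree_weight_inj)
    show "size t = size t'" using t by (simp add: trees_def)
    fix p assume "p < size t"
    then have "p < n" using t by (simp add: trees_def)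
    then show "tree_weight t p = tree_weight t' p"
      using loday_point_coordinate[OF e t(1)] loday_point_coordinate[OF e t(2)] eq
      by (metis of_nat_eq_iff)
  qed
qed

lemma associahedron_in_loday_polyhedron:
  assumes "n \<ge> 1" and e: "bij_betw e UNIV {1..n}" and v: "v \<in> associahedron n e"
  shows "(\<lambda>p. v $ inv e (Suc p)) \<in> loday_polyhedron n"
proof -
  have "associahedron n e \<subseteq> {v. (\<lambda>p. v $ inv e (Suc p)) \<in> loday_polyhedron n}"
    unfolding associahedron_def
  proof (rule hull_minimal)
    show "loday_point e ` triangulations n \<subseteq> {v. (\<lambda>p. v $ inv e (Suc p)) \<in> loday_polyhedron n}"
    proof clarify
      fix T assume "T \<in> triangulations n"
      then obtain t where t: "t \<in> trees n" "T = tree_triangles 0 t"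
        using triangulations_eq_trees[OF assms(1)] by auto
      have "(\<lambda>p. real (tree_weight t p)) \<in> loday_polyhedron n"
        using tree_weight_in_loday_polyhedron[of t] t by (simp add: trees_def)
      then show "(\<lambda>p. loday_point e T $ inv e (Suc p)) \<in> loday_polyhedron n"
        unfolding loday_polyhedron_def t(2)
        by (auto simp: loday_point_coordinate[OF e t(1)])
    qed
    show "convex {v. (\<lambda>p. v $ inv e (Suc p)) \<in> loday_polyhedron n}"
      unfolding convex_def by (auto intro: loday_polyhedron_convex)
  qed
  then show ?thesis using v by blast
qed

text \<open>The whole associahedron lies in the polyhedron of interval inequalities, so the extremality of a
  tree's point within the polyhedron carries over.\<close>

lemma polytope_vertices_associahedron:
  assumes "n \<ge> 1" and e: "bij_betw e UNIV {1..n}"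
  shows "polytope_vertices (associahedron n e) = loday_point e ` triangulations n"
proof (intro equalityI subsetI)
  fix v assume "v \<in> polytope_vertices (associahedron n e)"
  then show "v \<in> loday_point e ` triangulations n"
    unfolding polytope_vertices_def associahedron_def by (auto dest: extreme_point_of_convex_hull)
next
  fix w assume w: "w \<in> loday_point e ` triangulations n"
  then obtain t where t: "t \<in> trees n" "w = loday_point e (tree_triangles 0 t)"
    using triangulations_eq_trees[OF assms(1)] by auto
  have n: "size t = n" using t by (simp add: trees_def)
  have coord: "w $ inv e (Suc p) = real (tree_weight t p)" if "p < n" for p
    using loday_point_coordinate[OF e t(1) that] t(2) by simp
  have endpoint: "x = w" if "x \<in> associahedron n e" "y \<in> associahedron n e"
    and uv: "0 < u" "0 < v" "u + v = 1" and comb: "w = u *\<^sub>R x + v *\<^sub>R y" for x y u v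
  proof -
    have "u * x $ inv e (Suc (0 + p)) + v * y $ inv e (Suc (0 + p)) = real (tree_weight t p)"
      if "p < size t" for p
      using coord[of p] that n comb by simp
    then have "\<forall>p<size t. x $ inv e (Suc (0 + p)) = real (tree_weight t p)"
      using loday_polyhedron_extreme[OF associahedron_in_loday_polyhedron[OF assms that(1)]
        associahedron_in_loday_polyhedron[OF assms that(2)] uv, of 0 t] n
      by simp
    then show "x = w"
      unfolding vec_eq_iff_coordinates[OF e] using coord n by simp
  qed
  have "w \<notin> open_segment x y" if xy: "x \<in> associahedron n e" "y \<in> associahedron n e" for x y
  proof
    assume "w \<in> open_segment x y"
    then obtain u where u: "x \<noteq> y" "0 < u" "u < 1" "w = (1 - u) *\<^sub>R x + u *\<^sub>R y"
      unfolding in_segment by blast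
    have "x = w" using endpoint[OF xy, of "1 - u" u] u by simp
    moreover have "y = w" using endpoint[OF xy(2,1), of u "1 - u"] u by (simp add: add.commute)
    ultimately show False using u(1) by simp
  qed
  moreover have "w \<in> associahedron n e"
    unfolding associahedron_def using w by (rule hull_inc)
  ultimately show "w \<in> polytope_vertices (associahedron n e)"
    unfolding polytope_vertices_def extreme_point_of_def by blast
qed

lemma sum_loday_points:
  assumes "n \<ge> 1" and e: "bij_betw e UNIV {1..n}"
  shows "(\<Sum>t\<in>trees n. loday_point e (tree_triangles 0 t))
    = catalan n *\<^sub>R (\<chi> a. (real n + 1) / 2)"
proof (subst vec_eq_iff, intro allI)
  fix a
  have "e a \<in> {1..n}" using e by (auto simp: bij_betw_def)
  then have "weight_sum n (e a - 1) = (real n + 1) / 2 * catalan n"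
    by (intro weight_sum_eq) auto
  then show "(\<Sum>t\<in>trees n. loday_point e (tree_triangles 0 t)) $ a
      = (catalan n *\<^sub>R (\<chi> a. (real n + 1) / 2)) $ a"
    by (simp add: loday_point_tree_triangles[OF e] weight_sum_def)
qed

theorem theorem2p1:
  fixes n :: nat and e :: "'d::finite \<Rightarrow> nat" and G :: "real ^ 'd"
  assumes "n \<ge> 1"
    and "bij_betw e UNIV {1..n}"
    and "G = (\<chi> a. (real n + 1) / 2)"
  shows "center_of_gravity (associahedron n e) = G \<and>
         (\<Sum>T\<in>triangulations n. loday_point e T - G) = 0"
proof -
  let ?M = "\<lambda>t. loday_point e (tree_triangles 0 t)"
  note inj = inj_on_loday_point[OF assms(1,2)]
  have tri: "triangulations n = tree_triangles 0 ` trees n"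
    using assms(1) by (rule triangulations_eq_trees)
  have sum: "(\<Sum>t\<in>trees n. ?M t) = catalan n *\<^sub>R G"
    using sum_loday_points[OF assms(1,2)] assms(3) by simp
  have vertices: "polytope_vertices (associahedron n e) = ?M ` trees n"
    using polytope_vertices_associahedron[OF assms(1,2)] tri by (simp add: image_image)
  have "catalan n > 0"
  proof (cases n)
    case (Suc m)
    have "(Node Leaf ^^ n) Leaf \<in> trees n" for n by (induction n) (auto simp: trees_def)
    then show ?thesis using finite_trees by (auto simp: catalan_def card_gt_0_iff)
  qed (simp add: catalan_0)
  moreover have "card (?M ` trees n) = card (trees n)"
    using inj by (rule card_image)
  moreover have "\<Sum>(?M ` trees n) = catalan n *\<^sub>R G"
    using sum by (simp add: sum.reindex[OF inj])
  ultimately have "center_of_gravity (associahedron n e) = G"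
    unfolding center_of_gravity_def vertices by (simp add: catalan_def)
  moreover have "(\<Sum>T\<in>triangulations n. loday_point e T - G) = 0"
  proof -
    have "inj_on (tree_triangles 0) (trees n)"
      using inj inj_on_imageI2[of "loday_point e" "tree_triangles 0" "trees n"] by (simp add: o_def)
    then have "(\<Sum>T\<in>triangulations n. loday_point e T - G) = (\<Sum>t\<in>trees n. ?M t - G)"
      unfolding tri by (simp add: sum.reindex)
    also have "\<dots> = 0"
      using sum by (simp add: sum_subtractf catalan_def sum_constant_scaleR del: sum_constant)
    finally show ?thesis .
  qed
  ultimately show ?thesis ..
qed

end
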